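(* Let $f:\mathbb{R}^n\to\mathbb{R}$ be convex and locally Lipschitz continuous, let $\lambda>0$, let $F$ be the Moreau-Yosida regularization of $f$ with parameter $\lambda$ and $g=\nabla F$, and let $\{x_k\}_{k\ge 0}$, $\{d_k\}$, $\{\varepsilon_k\}$ be infinite sequences generated by Algorithm W (described in the context). Assume: (1) the level set $\{x\in\mathbb{R}^n : F(x)\le F(x_0)\}$ is bounded; (2) $f$, and hence $F$, is bounded below on $\mathbb{R}^n$; (3) $\varepsilon_k\downarrow 0$ and $\varepsilon_k=o(\|d_k\|^2)$ as $k\to\infty$, i.e. $\varepsilon_k/\|d_k\|^2\to 0$. Then $$\lim_{k\to\infty}\|g(x_k)\|=0,$$ and every accumulation point of $\{x_k\}$ is a minimizer of $f$ over $\mathbb{R}^n$ (equivalently, a minimizer of $F$ over $\mathbb{R}^n$).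
   Context: $\|\cdot\|$ is the Euclidean norm on $\mathbb{R}^n$. Moreau-Yosida regularization: $F(x)=\min_{z\in\mathbb{R}^n}\{f(z)+\frac{1}{2\lambda}\|z-x\|^2\}$, $p(x)=\arg\min_{z\in\mathbb{R}^n}\{f(z)+\frac1{2\lambda}\|z-x\|^2\}$. $F$ is finite, convex and differentiable, with gradient $g(x)=\nabla F(x)=(x-p(x))/\lambda$. Inexact quantities: for each $x\in\mathbb{R}^n$ and $\varepsilon>0$, $p^a(x,\varepsilon)$ denotes a chosen point satisfying $f(p^a(x,\varepsilon))+\frac1{2\lambda}\|p^a(x,\varepsilon)-x\|^2\le F(x)+\varepsilon$. Set $F^a(x,\varepsilon)=f(p^a(x,\varepsilon))+\frac{1}{2\lambda}\|p^a(x,\varepsilon)-x\|^2$ and $g^a(x,\varepsilon)=(x-p^a(x,\varepsilon))/\lambda$. Algorithm W. Parameters: $x_0\in\mathbb{R}^n$, $\lambda>0$, $0<\delta\le\sigma<1$, $0<\eta<\frac34$, $\tau>\frac14+\eta$, $\varepsilon_0\in(0,1)$, safeguard $\rho_0>0$. Set $\tilde g_0=g^a(x_0,\varepsilon_0)$, $d_0=-\tilde g_0$, $\theta_0=1$. For $k=0,1,2,\dots$: Step 1. If $\tilde g_k=0$, stop. Step 2. Choose $\varepsilon_{k+1}\in(0,\varepsilon_k)$ and a step length $\alpha_k>0$ such that, with $x_{k+1}=x_k+\alpha_kd_k$ and $\tilde g_{k+1}=g^a(x_{k+1},\varepsilon_{k+1})$, the Wolfe-type conditions hold: $$F^a(x_k+\alpha_kd_k,\varepsilon_{k+1})-F^a(x_k,\varepsilon_k)\le\delta\alpha_k\tilde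 g_k^\top d_k,\qquad \tilde g_{k+1}^\top d_k\ge\sigma\tilde g_k^\top d_k.$$ Step 3. Set $y_k=\tilde g_{k+1}-\tilde g_k$. Step 4. If $|d_k^\top y_k|<\rho_0$, set $\beta_k=0$, $\theta_{k+1}=1$. Otherwise let $$\hat\beta_k=\frac{\tilde g_{k+1}^\top y_k}{d_k^\top y_k}-\|y_k\|^2\frac{d_k^\top\tilde g_{k+1}}{(d_k^\top y_k)^2},\qquad \theta^{QN}_{k+1}=1-\|y_k\|^2\frac{d_k^\top\tilde g_{k+1}}{(d_k^\top y_k)(y_k^\top\tilde g_{k+1})};$$ set $\beta_k=\hat\beta_k$ if $|\hat\beta_k|\,\|d_k\|\le\frac14\|\tilde g_{k+1}\|$, and $\beta_k=\operatorname{sign}(\hat\beta_k)\frac{\|\tilde g_{k+1}\|}{4\|d_k\|}$ otherwise; set $\theta_{k+1}=\theta^{QN}_{k+1}$ if $\theta^{QN}_{k+1}$ is defined and lies in $[\frac14+\eta,\tau]$, and $\theta_{k+1}=1$ otherwise. Step 5. Set $d_{k+1}=-\theta_{k+1}\tilde g_{k+1}+\beta_kd_k$ and continue with $k+1$. It is assumed that step lengths satisfying Step 2 are found at every iteration performed. *)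

theory Defs
  imports "HOL-Analysis.Analysis"
begin

definition my_objective :: "('a::real_normed_vector \<Rightarrow> real) \<Rightarrow> real \<Rightarrow> 'a \<Rightarrow> 'a \<Rightarrow> real" where
  "my_objective f lam x z = f z + 1 / (2 * lam) * (norm (z - x))\<^sup>2"

(* Moreau-Yosida regularization F. The infimum is a minimum for convex f on a Euclidean
   space and lam > 0; see moreau_yosida_attained below. *)
definition moreau_yosida :: "('a::real_normed_vector \<Rightarrow> real) \<Rightarrow> real \<Rightarrow> 'a \<Rightarrow> real" where
  "moreau_yosida f lam x = (INF z. my_objective f lam x z)"

lemma moreau_yosida_attained:
  fixes f :: "'a::euclidean_space \<Rightarrow> real"
  assumes cvx: "convex_on UNIV f" and lam: "lam > 0"
  shows "\<exists>p. my_objective f lam x p = moreau_yosida f lam x \<and>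
             (\<forall>z. my_objective f lam x p \<le> my_objective f lam x z)"
proof -
  let ?h = "my_objective f lam x"
  have cf: "continuous_on S f" for S
    using convex_on_continuous[OF open_UNIV cvx] continuous_on_subset by blast
  obtain w0 where w0: "\<And>w. w \<in> cball x 1 \<Longrightarrow> f w0 \<le> f w"
    using continuous_attains_inf[OF compact_cball _ cf, of x 1] by force
  define R where "R = max 1 (2 * lam * (f x - f w0))"
  have ch: "continuous_on (cball x R) ?h"
    unfolding my_objective_def by (intro continuous_intros cf)
  have "cball x R \<noteq> {}" by (simp add: R_def)
  then obtain p where p: "\<And>z. z \<in> cball x R \<Longrightarrow> ?h p \<le> ?h z"
    using continuous_attains_inf[OF compact_cball _ ch] by blast
  have min: "?h p \<le> ?h z" for z
  proof (cases "z \<in> cball x R")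
    case True then show ?thesis by (rule p)
  next
    case False
    define r where "r = norm (z - x)"
    have r: "r > R" using False by (simp add: r_def dist_norm norm_minus_commute)
    have r1: "r > 1" and r2: "2 * lam * (f x - f w0) \<le> r" using r by (auto simp: R_def)
    define w where "w = (1 - 1/r) *\<^sub>R x + (1/r) *\<^sub>R z"
    have "w - x = (1/r) *\<^sub>R (z - x)" by (simp add: w_def algebra_simps)
    then have "norm (w - x) = 1" using r1 by (auto simp: r_def)
    then have "f w0 \<le> f w" by (intro w0) (simp add: dist_norm norm_minus_commute)
    also have "\<dots> \<le> (1 - 1/r) * f x + (1/r) * f z"
      unfolding w_def using r1 by (intro convex_onD[OF cvx]) auto
    finally have "r * f w0 \<le> r * ((1 - 1/r) * f x + (1/r) * f z)"
      using r1 by (intro mult_left_mono) auto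
    also have "\<dots> = r * f x - f x + f z" using r1 by (simp add: field_simps)
    finally have a: "f x - r * (f x - f w0) \<le> f z" by (simp add: algebra_simps)
    have "r * (2 * lam * (f x - f w0)) \<le> r * r" using r2 r1 by (intro mult_left_mono) auto
    then have "r * (f x - f w0) \<le> 1 / (2 * lam) * r\<^sup>2"
      using lam by (simp add: field_simps power2_eq_square)
    with a have "f x \<le> ?h z" by (simp add: my_objective_def r_def)
    moreover have "?h p \<le> ?h x" by (intro p) (simp add: R_def)
    ultimately show ?thesis by (simp add: my_objective_def)
  qed
  have "moreau_yosida f lam x = ?h p"
    unfolding moreau_yosida_def using min by (intro cInf_eq_minimum) auto
  with min show ?thesis by auto
qed

(* The Moreau-Yosida regularization of a convex function is differentiable, so the description
   denotes its actual gradient. *)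
definition gradient :: "('a::real_inner \<Rightarrow> real) \<Rightarrow> 'a \<Rightarrow> 'a" where
  "gradient F x = (THE D. GDERIV F x :> D)"

(* pa is an arbitrary selection x, e |-> p^a(x, e); nothing is required for e \<le> 0. *)
definition inexact_prox ::
    "('a::real_normed_vector \<Rightarrow> real) \<Rightarrow> real \<Rightarrow> ('a \<Rightarrow> real \<Rightarrow> 'a) \<Rightarrow> bool" where
  "inexact_prox f lam pa \<longleftrightarrow>
     (\<forall>x e. e > 0 \<longrightarrow> my_objective f lam x (pa x e) \<le> moreau_yosida f lam x + e)"

definition F_inexact ::
    "('a::real_normed_vector \<Rightarrow> real) \<Rightarrow> real \<Rightarrow> ('a \<Rightarrow> real \<Rightarrow> 'a) \<Rightarrow> 'a \<Rightarrow> real \<Rightarrow> real" where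
  "F_inexact f lam pa x e = my_objective f lam x (pa x e)"

definition g_inexact ::
    "real \<Rightarrow> ('a::real_normed_vector \<Rightarrow> real \<Rightarrow> 'a) \<Rightarrow> 'a \<Rightarrow> real \<Rightarrow> 'a" where
  "g_inexact lam pa x e = (1 / lam) *\<^sub>R (x - pa x e)"

(* In the following, d = d_k, y = y_k and g is the inexact gradient at x_{k+1}. *)

definition beta_hat :: "'a::real_inner \<Rightarrow> 'a \<Rightarrow> 'a \<Rightarrow> real" where
  "beta_hat d y g = (g \<bullet> y) / (d \<bullet> y) - (norm y)\<^sup>2 * ((d \<bullet> g) / (d \<bullet> y)\<^sup>2)"

definition theta_QN :: "'a::real_inner \<Rightarrow> 'a \<Rightarrow> 'a \<Rightarrow> real" where
  "theta_QN d y g = 1 - (norm y)\<^sup>2 * ((d \<bullet> g) / ((d \<bullet> y) * (y \<bullet> g)))"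

definition beta_W :: "real \<Rightarrow> 'a::real_inner \<Rightarrow> 'a \<Rightarrow> 'a \<Rightarrow> real" where
  "beta_W rho d y g =
     (if \<bar>d \<bullet> y\<bar> < rho then 0
      else if \<bar>beta_hat d y g\<bar> * norm d \<le> 1/4 * norm g then beta_hat d y g
      else sgn (beta_hat d y g) * (norm g / (4 * norm d)))"

(* "theta_QN is defined" means that its denominator is nonzero. *)
definition theta_W :: "real \<Rightarrow> real \<Rightarrow> real \<Rightarrow> 'a::real_inner \<Rightarrow> 'a \<Rightarrow> 'a \<Rightarrow> real" where
  "theta_W eta tau rho d y g =
     (if \<bar>d \<bullet> y\<bar> < rho then 1
      else if (d \<bullet> y) * (y \<bullet> g) \<noteq> 0 \<and> theta_QN d y g \<in> {1/4 + eta..tau} then theta_QN d y g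
      else 1)"

(* Infinite runs only: the stopping test fails at every iteration. *)
definition algorithm_W_run ::
    "('a::real_inner \<Rightarrow> real) \<Rightarrow> real \<Rightarrow> ('a \<Rightarrow> real \<Rightarrow> 'a) \<Rightarrow>
     real \<Rightarrow> real \<Rightarrow> real \<Rightarrow> real \<Rightarrow> real \<Rightarrow>
     (nat \<Rightarrow> 'a) \<Rightarrow> (nat \<Rightarrow> 'a) \<Rightarrow> (nat \<Rightarrow> real) \<Rightarrow>
     (nat \<Rightarrow> real) \<Rightarrow> (nat \<Rightarrow> real) \<Rightarrow> (nat \<Rightarrow> real) \<Rightarrow> bool" where
  "algorithm_W_run f lam pa delta sig eta tau rho x d eps alpha beta theta \<longleftrightarrow>
     (let Fa = F_inexact f lam pa;
          gt = (\<lambda>k. g_inexact lam pa (x k) (eps k));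
          y = (\<lambda>k. gt (Suc k) - gt k)
      in d 0 = - gt 0 \<and> theta 0 = 1 \<and>
         (\<forall>k. gt k \<noteq> 0 \<and>
              0 < eps (Suc k) \<and> eps (Suc k) < eps k \<and> 0 < alpha k \<and>
              x (Suc k) = x k + alpha k *\<^sub>R d k \<and>
              Fa (x k + alpha k *\<^sub>R d k) (eps (Suc k)) - Fa (x k) (eps k)
                \<le> delta * alpha k * (gt k \<bullet> d k) \<and>
              gt (Suc k) \<bullet> d k \<ge> sig * (gt k \<bullet> d k) \<and>
              beta k = beta_W rho (d k) (y k) (gt (Suc k)) \<and>
              theta (Suc k) = theta_W eta tau rho (d k) (y k) (gt (Suc k)) \<and>
              d (Suc k) = - theta (Suc k) *\<^sub>R gt (Suc k) + beta k *\<^sub>R d k))"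

end

theory Submission
  imports Defs
begin

text \<open>
  Both the envelope and its gradient can be handled without subdifferentials, because the
  objective defining the proximal point \<open>p(x)\<close> grows quadratically away from \<open>p(x)\<close>
  (\<open>my_objective_quadratic_growth\<close>). This growth gives three things. The map
  \<open>g(x) = (x - p(x)) / \<lambda>\<close> is Lipschitz with constant \<open>1 / \<lambda>\<close>; it is the gradient of the
  envelope \<open>F\<close>, since comparing \<open>F(x)\<close> and \<open>F(y)\<close> with the same competitor pins \<open>F\<close> to its
  linearization up to a quadratic error; and the inexact gradient differs from \<open>g\<close> by at most
  \<open>\<surd>(2 \<epsilon> / \<lambda>)\<close>.

  The truncation of \<open>\<beta>\<close> and the safeguard on \<open>\<theta>\<close> force, whatever the values of the conjugate
  gradient formulas, the bounds \<open>gt \<bullet> d \<le> - \<eta> \<parallel>gt\<parallel>\<^sup>2\<close> and \<open>\<parallel>d\<parallel> \<le> C \<parallel>gt\<parallel>\<close>, where \<open>gt\<close> is the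
  inexact gradient. The inexact values of \<open>F\<close> decrease along the run and are bounded below, so
  the guaranteed decreases \<open>- \<alpha> gt \<bullet> d\<close> tend to zero. The curvature condition and the Lipschitz
  bound give
  \<open>(1 - \<sigma>) \<eta> / C\<^sup>2 \<le> \<alpha> / \<lambda> + 2 \<surd>(2 \<epsilon> / (\<lambda> \<parallel>d\<parallel>\<^sup>2))\<close>. As \<open>\<epsilon> = o(\<parallel>d\<parallel>\<^sup>2)\<close>, the last term vanishes
  in the limit, so the step lengths stay away from zero. Hence \<open>gt\<close>, and with it \<open>g(x\<^sub>k)\<close>, tends
  to zero. By continuity \<open>g\<close> vanishes at every accumulation point \<open>l\<close>; then \<open>p(l) = l\<close>, and
  quadratic growth around \<open>l\<close> cancels the proximal term exactly, leaving \<open>f(l) \<le> f(z)\<close>.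
\<close>

section \<open>The proximal point and the gradient of the envelope\<close>

definition prox :: "('a::euclidean_space \<Rightarrow> real) \<Rightarrow> real \<Rightarrow> 'a \<Rightarrow> 'a" where
  "prox f lam x = (SOME p. my_objective f lam x p = moreau_yosida f lam x)"

definition prox_residual :: "('a::euclidean_space \<Rightarrow> real) \<Rightarrow> real \<Rightarrow> 'a \<Rightarrow> 'a" where
  "prox_residual f lam x = (1 / lam) *\<^sub>R (x - prox f lam x)"

context
  fixes f :: "'a::euclidean_space \<Rightarrow> real" and lam :: real
  assumes cvx: "convex_on UNIV f" and lam: "lam > 0"
begin

lemma my_objective_prox: "my_objective f lam x (prox f lam x) = moreau_yosida f lam x"
  using someI_ex[of "\<lambda>p. my_objective f lam x p = moreau_yosida f lam x"]
    moreau_yosida_attained[OF cvx lam, of x] unfolding prox_def by blast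

lemma moreau_yosida_le: "moreau_yosida f lam x \<le> my_objective f lam x z"
  using moreau_yosida_attained[OF cvx lam, of x] by auto

text \<open>
  The objective is a convex function plus \<open>1 / (2 \<lambda>)\<close> times a squared distance, hence strongly
  convex. Comparing the minimum with the value at \<open>p + t (z - p)\<close> gives the estimate with the
  factor \<open>1 - t\<close> in front of the square; then \<open>t\<close> tends to zero.
\<close>

lemma my_objective_quadratic_growth:
  "moreau_yosida f lam x + 1 / (2 * lam) * (norm (z - prox f lam x))\<^sup>2 \<le> my_objective f lam x z"
proof -
  define p where "p = prox f lam x"
  define q where "q = 1 / (2 * lam) * (norm (z - p))\<^sup>2"
  let ?h = "my_objective f lam x"
  have main: "?h p + (1 - t) * q \<le> ?h z" if t: "0 < t" "t < 1" for t :: real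
  proof -
    define w where "w = (1 - t) *\<^sub>R p + t *\<^sub>R z"
    have f: "f w \<le> (1 - t) * f p + t * f z"
      unfolding w_def using t by (intro convex_onD[OF cvx]) auto
    have wx: "w - x = (1 - t) *\<^sub>R (p - x) + t *\<^sub>R (z - x)"
      by (simp add: w_def algebra_simps)
    have zp: "z - p = (z - x) - (p - x)" by simp
    have n: "(norm (w - x))\<^sup>2
        = (1 - t) * (norm (p - x))\<^sup>2 + t * (norm (z - x))\<^sup>2 - t * (1 - t) * (norm (z - p))\<^sup>2"
      unfolding wx zp power2_norm_eq_inner
      by (simp add: inner_simps inner_commute algebra_simps)
    have "?h p \<le> ?h w" unfolding p_def my_objective_prox by (rule moreau_yosida_le)
    also have "\<dots> \<le> (1 - t) * f p + t * f z + 1 / (2 * lam) * (norm (w - x))\<^sup>2"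
      using f by (simp add: my_objective_def)
    also have "\<dots> = (1 - t) * ?h p + t * ?h z - t * (1 - t) * q"
      unfolding n my_objective_def q_def by (simp add: algebra_simps diff_divide_distrib add_divide_distrib)
    finally have "t * (?h p + (1 - t) * q) \<le> t * ?h z" by (simp add: algebra_simps)
    then show ?thesis using t by simp
  qed
  have lim: "((\<lambda>t. ?h p + (1 - t) * q) \<longlongrightarrow> ?h p + (1 - 0) * q) (at_right 0)"
    by (intro tendsto_intros)
  have "\<forall>\<^sub>F t in at_right 0. ?h p + (1 - t) * q \<le> ?h z"
    using main by (intro eventually_at_rightI[of 0 1]) auto
  from tendsto_upperbound[OF lim this] show ?thesis
    using my_objective_prox[of x] by (simp add: p_def q_def)
qed

text \<open>
  Adding the growth estimates at \<open>x\<close> and at \<open>y\<close>, each tested with the proximal point of the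
  other, makes the values of \<open>f\<close> cancel and leaves an inequality between inner products.
\<close>

lemma prox_firmly_nonexpansive:
  "(norm (prox f lam x - prox f lam y))\<^sup>2 \<le> (x - y) \<bullet> (prox f lam x - prox f lam y)"
proof -
  define p q where "p = prox f lam x" and "q = prox f lam y"
  have 1: "f p + 1 / (2 * lam) * (norm (p - x))\<^sup>2 + 1 / (2 * lam) * (norm (q - p))\<^sup>2
      \<le> f q + 1 / (2 * lam) * (norm (q - x))\<^sup>2"
    using my_objective_quadratic_growth[of x q] my_objective_prox[of x]
    by (simp add: my_objective_def p_def)
  have 2: "f q + 1 / (2 * lam) * (norm (q - y))\<^sup>2 + 1 / (2 * lam) * (norm (p - q))\<^sup>2
      \<le> f p + 1 / (2 * lam) * (norm (p - y))\<^sup>2"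
    using my_objective_quadratic_growth[of y p] my_objective_prox[of y]
    by (simp add: my_objective_def q_def)
  have "1 / (2 * lam) * ((norm (p - x))\<^sup>2 + (norm (q - p))\<^sup>2 + (norm (q - y))\<^sup>2 + (norm (p - q))\<^sup>2)
      \<le> 1 / (2 * lam) * ((norm (q - x))\<^sup>2 + (norm (p - y))\<^sup>2)"
    using 1 2 unfolding distrib_left by linarith
  then have "(norm (p - x))\<^sup>2 + (norm (q - p))\<^sup>2 + (norm (q - y))\<^sup>2 + (norm (p - q))\<^sup>2
      \<le> (norm (q - x))\<^sup>2 + (norm (p - y))\<^sup>2"
    using lam by (simp add: divide_le_cancel)
  then show ?thesis unfolding p_def[symmetric] q_def[symmetric]
    by (simp add: power2_norm_eq_inner inner_simps inner_commute)
qed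

lemma prox_residual_Lipschitz:
  "norm (prox_residual f lam x - prox_residual f lam y) \<le> norm (x - y) / lam"
proof -
  define u v where "u = x - y" and "v = prox f lam x - prox f lam y"
  have "v \<bullet> v \<le> u \<bullet> v"
    using prox_firmly_nonexpansive[of x y] by (simp add: u_def v_def power2_norm_eq_inner)
  moreover have "0 \<le> v \<bullet> v" by simp
  ultimately have "v \<bullet> v \<le> 2 * (u \<bullet> v)" by linarith
  then have "(norm (u - v))\<^sup>2 \<le> (norm u)\<^sup>2"
    by (simp add: power2_norm_eq_inner inner_simps inner_commute)
  then have n: "norm (u - v) \<le> norm u" by (rule power2_le_imp_le) simp
  have "prox_residual f lam x - prox_residual f lam y = (1 / lam) *\<^sub>R (u - v)"
    by (simp add: prox_residual_def u_def v_def algebra_simps)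
  then show ?thesis using n lam by (simp add: u_def divide_right_mono)
qed

text \<open>
  The proximal point of \<open>x\<close> is a competitor in the minimization that defines the envelope at \<open>y\<close>.
\<close>

lemma moreau_yosida_upper_model:
  "moreau_yosida f lam y \<le> moreau_yosida f lam x + prox_residual f lam x \<bullet> (y - x)
     + 1 / (2 * lam) * (norm (y - x))\<^sup>2"
proof -
  define p where "p = prox f lam x"
  have e: "(norm (p - y))\<^sup>2 = (norm (p - x))\<^sup>2 + 2 * ((x - p) \<bullet> (y - x)) + (norm (y - x))\<^sup>2"
    by (simp add: power2_norm_eq_inner inner_simps inner_commute)
  have "moreau_yosida f lam y \<le> my_objective f lam y p" by (rule moreau_yosida_le)
  also have "\<dots> = my_objective f lam x p + 1 / lam * ((x - p) \<bullet> (y - x))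
      + 1 / (2 * lam) * (norm (y - x))\<^sup>2"
    unfolding my_objective_def e using lam by (simp add: field_simps)
  finally show ?thesis
    by (simp add: prox_residual_def my_objective_prox p_def)
qed

text \<open>
  The matching lower model comes from exchanging \<open>x\<close> and \<open>y\<close> in the upper model; moving the slope
  back from \<open>y\<close> to \<open>x\<close> costs another quadratic term by the Lipschitz bound.
\<close>

lemma GDERIV_moreau_yosida: "GDERIV (moreau_yosida f lam) x :> prox_residual f lam x"
proof -
  let ?F = "moreau_yosida f lam" and ?g = "prox_residual f lam"
  define K where "K = 3 / (2 * lam)"
  have K: "\<bar>?F y - ?F x - (y - x) \<bullet> ?g x\<bar> \<le> K * (norm (y - x))\<^sup>2" for y
  proof -
    have "(?g x - ?g y) \<bullet> (y - x) \<le> norm (?g x - ?g y) * norm (y - x)"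
      by (rule norm_cauchy_schwarz)
    also have "\<dots> \<le> norm (x - y) / lam * norm (y - x)"
      by (intro mult_right_mono prox_residual_Lipschitz) simp
    finally have a: "?g x \<bullet> (y - x) - ?g y \<bullet> (y - x) \<le> 1 / lam * (norm (y - x))\<^sup>2"
      by (simp add: power2_eq_square norm_minus_commute inner_diff_left)
    have b: "?F x \<le> ?F y - ?g y \<bullet> (y - x) + 1 / (2 * lam) * (norm (y - x))\<^sup>2"
      using moreau_yosida_upper_model[of x y]
      by (simp add: norm_minus_commute inner_diff_right)
    have c: "?F y \<le> ?F x + ?g x \<bullet> (y - x) + 1 / (2 * lam) * (norm (y - x))\<^sup>2"
      by (rule moreau_yosida_upper_model)
    have d: "K * (norm (y - x))\<^sup>2
        = 1 / lam * (norm (y - x))\<^sup>2 + 1 / (2 * lam) * (norm (y - x))\<^sup>2"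
      using lam by (simp add: K_def field_simps)
    have e: "0 \<le> 1 / lam * (norm (y - x))\<^sup>2" using lam by simp
    show ?thesis unfolding d inner_commute[of "y - x"] using a b c e by linarith
  qed
  have "((\<lambda>y. (?F y - ?F x - (y - x) \<bullet> ?g x) /\<^sub>R norm (y - x)) \<longlongrightarrow> 0) (at x)"
  proof (rule Lim_null_comparison)
    show "\<forall>\<^sub>F y in at x. norm ((?F y - ?F x - (y - x) \<bullet> ?g x) /\<^sub>R norm (y - x)) \<le> K * norm (y - x)"
    proof (rule eventually_mono[OF eventually_neq_at_within[of x x UNIV]])
      fix y assume "y \<noteq> x"
      then show "norm ((?F y - ?F x - (y - x) \<bullet> ?g x) /\<^sub>R norm (y - x)) \<le> K * norm (y - x)"
        using K[of y] by (simp add: field_simps power2_eq_square)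
    qed
    have "((\<lambda>y. K * norm (y - x)) \<longlongrightarrow> K * norm (x - x)) (at x)" by (intro tendsto_intros)
    then show "((\<lambda>y. K * norm (y - x)) \<longlongrightarrow> 0) (at x)" by simp
  qed
  then show ?thesis
    unfolding gderiv_def has_derivative_within
    by (simp add: bounded_linear_inner_left diff_diff_eq divide_inverse_commute)
qed

lemma gradient_moreau_yosida: "gradient (moreau_yosida f lam) x = prox_residual f lam x"
  unfolding gradient_def
proof (rule the_equality)
  show "GDERIV (moreau_yosida f lam) x :> prox_residual f lam x"
    by (rule GDERIV_moreau_yosida)
next
  fix D assume "GDERIV (moreau_yosida f lam) x :> D"
  then have "(\<lambda>h. h \<bullet> D) = (\<lambda>h. h \<bullet> prox_residual f lam x)"
    using GDERIV_moreau_yosida[of x] unfolding gderiv_def by (rule has_derivative_unique)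
  then have "\<forall>h. h \<bullet> D = h \<bullet> prox_residual f lam x" by (simp add: fun_eq_iff)
  then show "D = prox_residual f lam x" by (simp add: vector_eq_ldot)
qed

lemma g_inexact_error:
  assumes pa: "inexact_prox f lam pa" and e: "e > 0"
  shows "norm (g_inexact lam pa x e - prox_residual f lam x) \<le> sqrt (2 * e / lam)"
proof (rule real_le_rsqrt)
  have "1 / (2 * lam) * (norm (pa x e - prox f lam x))\<^sup>2 \<le> e"
    using my_objective_quadratic_growth[of x "pa x e"] pa e
    unfolding inexact_prox_def by (meson add_le_cancel_left order_trans)
  then have "(norm (pa x e - prox f lam x))\<^sup>2 \<le> 2 * lam * e"
    using lam by (simp add: field_simps)
  then have "(norm (pa x e - prox f lam x))\<^sup>2 / lam\<^sup>2 \<le> 2 * lam * e / lam\<^sup>2"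
    by (rule divide_right_mono) simp
  moreover have "g_inexact lam pa x e - prox_residual f lam x = (1 / lam) *\<^sub>R (prox f lam x - pa x e)"
    by (simp add: g_inexact_def prox_residual_def algebra_simps)
  ultimately show "(norm (g_inexact lam pa x e - prox_residual f lam x))\<^sup>2 \<le> 2 * e / lam"
    using lam by (simp add: power_divide power2_eq_square norm_minus_commute)
qed

text \<open>
  When \<open>x\<close> is its own proximal point, the quadratic growth around \<open>x\<close> has exactly the
  coefficient of the proximal term, so both cancel.
\<close>

lemma stationary_imp_minimizer:
  assumes "prox_residual f lam x = 0"
  shows "f x \<le> f z" and "moreau_yosida f lam x \<le> moreau_yosida f lam z"
proof -
  have p: "prox f lam x = x" using assms lam by (simp add: prox_residual_def)
  then have F: "moreau_yosida f lam x = f x"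
    using my_objective_prox[of x] by (simp add: my_objective_def)
  show le: "f x \<le> f z" for z
    using my_objective_quadratic_growth[of x z] by (simp add: p F my_objective_def)
  have "f (prox f lam z) \<le> moreau_yosida f lam z"
    unfolding my_objective_prox[of z, symmetric] my_objective_def using lam by simp
  then show "moreau_yosida f lam x \<le> moreau_yosida f lam z"
    using le[of "prox f lam z"] F by simp
qed

end

section \<open>Search directions\<close>

lemma abs_beta_W_le: "\<bar>beta_W rho d y g\<bar> * norm d \<le> norm g / 4"
  by (auto simp: beta_W_def abs_mult abs_sgn_eq)

lemma theta_W_bounds:
  assumes "eta < 3/4"
  shows "1/4 + eta \<le> theta_W eta tau rho d y g" and "theta_W eta tau rho d y g \<le> max 1 tau"
  using assms by (auto simp: theta_W_def)

text \<open>
  By Cauchy-Schwarz the momentum term contributes at most \<open>\<parallel>g\<parallel>\<^sup>2 / 4\<close> to the slope; the lower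
  bound on \<open>th\<close> absorbs it and leaves the fraction \<open>eta\<close>.
\<close>

lemma truncated_direction_descent:
  fixes g d :: "'a::real_inner"
  assumes b: "\<bar>b\<bar> * norm d \<le> norm g / 4" and th: "1/4 + eta \<le> th"
  shows "g \<bullet> (- th *\<^sub>R g + b *\<^sub>R d) \<le> - eta * (norm g)\<^sup>2"
proof -
  have "b * (g \<bullet> d) \<le> \<bar>b\<bar> * \<bar>g \<bullet> d\<bar>" by (metis abs_ge_self abs_mult)
  also have "\<dots> \<le> \<bar>b\<bar> * (norm g * norm d)" by (intro mult_left_mono Cauchy_Schwarz_ineq2) simp
  also have "\<dots> = norm g * (\<bar>b\<bar> * norm d)" by simp
  also have "\<dots> \<le> norm g * (norm g / 4)" by (intro mult_left_mono b) simp
  finally have 1: "b * (g \<bullet> d) \<le> 1/4 * (norm g)\<^sup>2" by (simp add: power2_eq_square)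
  have "(1/4 + eta) * (norm g)\<^sup>2 \<le> th * (norm g)\<^sup>2" by (intro mult_right_mono th) simp
  with 1 show ?thesis by (simp add: inner_simps power2_norm_eq_inner algebra_simps)
qed

lemma truncated_direction_norm:
  fixes g d :: "'a::real_inner"
  assumes b: "\<bar>b\<bar> * norm d \<le> norm g / 4" and th: "0 \<le> th" "th \<le> T"
  shows "norm (- th *\<^sub>R g + b *\<^sub>R d) \<le> (T + 1/4) * norm g"
proof -
  have "norm (- th *\<^sub>R g + b *\<^sub>R d) \<le> th * norm g + \<bar>b\<bar> * norm d"
    using norm_triangle_ineq[of "- th *\<^sub>R g" "b *\<^sub>R d"] th by simp
  also have "\<dots> \<le> T * norm g + norm g / 4" by (intro add_mono mult_right_mono th b) simp
  finally show ?thesis by (simp add: algebra_simps)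
qed

section \<open>A line search with inexact gradients\<close>

text \<open>
  The decrease condition makes \<open>alpha k * (gt k \<bullet> d k)\<close> vanish in the limit; the curvature
  condition prevents \<open>alpha k\<close> from vanishing. Here \<open>Fa\<close> and \<open>gt\<close> are the inexact values and
  gradients, \<open>g\<close> is a Lipschitz gradient field, and \<open>err\<close> bounds the gradient error.
\<close>

lemma wolfe_inexact_gradient_tendsto_zero:
  fixes x d gt :: "nat \<Rightarrow> 'a::real_inner" and g :: "'a \<Rightarrow> 'a"
    and Fa alpha err :: "nat \<Rightarrow> real" and delta sig eta C L :: real
  assumes delta: "delta > 0" and sig: "sig < 1" and eta: "eta > 0" and C: "C > 0" and L: "L > 0"
    and step: "\<And>k. x (Suc k) = x k + alpha k *\<^sub>R d k" and alpha: "\<And>k. alpha k > 0"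
    and below: "\<And>k. m \<le> Fa k"
    and decrease: "\<And>k. Fa (Suc k) - Fa k \<le> delta * alpha k * (gt k \<bullet> d k)"
    and curvature: "\<And>k. gt (Suc k) \<bullet> d k \<ge> sig * (gt k \<bullet> d k)"
    and nonzero: "\<And>k. gt k \<noteq> 0"
    and descent: "\<And>k. gt k \<bullet> d k \<le> - eta * (norm (gt k))\<^sup>2"
    and bound: "\<And>k. norm (d k) \<le> C * norm (gt k)"
    and Lipschitz: "\<And>u v. norm (g u - g v) \<le> L * norm (u - v)"
    and err: "\<And>k. norm (gt k - g (x k)) \<le> err k" "decseq err"
    and err_little_o: "(\<lambda>k. err k / norm (d k)) \<longlonglongrightarrow> 0"
  shows "gt \<longlonglongrightarrow> 0"
proof -
  define A where "A = (1 - sig) * eta / C\<^sup>2"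
  have A: "A > 0" using sig eta C by (simp add: A_def)
  have neg: "gt k \<bullet> d k < 0" for k
    using descent[of k] nonzero[of k] eta
    by (smt (verit) mult_pos_pos zero_less_norm_iff zero_less_power mult_minus_left)
  then have d: "norm (d k) > 0" for k by (metis inner_zero_right less_irrefl zero_less_norm_iff)
  have key: "A \<le> L * alpha k + 2 * (err k / norm (d k))" for k
  proof -
    have "(norm (d k))\<^sup>2 \<le> (C * norm (gt k))\<^sup>2" by (intro power_mono bound) simp
    then have "(norm (d k))\<^sup>2 / C\<^sup>2 \<le> (norm (gt k))\<^sup>2"
      using C by (simp add: power_mult_distrib field_simps)
    then have "eta * ((norm (d k))\<^sup>2 / C\<^sup>2) \<le> eta * (norm (gt k))\<^sup>2"
      using eta by (intro mult_left_mono) auto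
    also have "\<dots> \<le> - (gt k \<bullet> d k)" using descent[of k] by simp
    finally have "(1 - sig) * (eta * ((norm (d k))\<^sup>2 / C\<^sup>2)) \<le> (1 - sig) * (- (gt k \<bullet> d k))"
      using sig by (intro mult_left_mono) auto
    then have "A * (norm (d k))\<^sup>2 \<le> (1 - sig) * (- (gt k \<bullet> d k))"
      by (simp add: A_def)
    also have "\<dots> \<le> (gt (Suc k) - gt k) \<bullet> d k"
      using curvature[of k] by (simp add: inner_diff_left algebra_simps)
    also have "\<dots> \<le> norm (gt (Suc k) - gt k) * norm (d k)" by (rule norm_cauchy_schwarz)
    also have "\<dots> \<le> (L * alpha k * norm (d k) + 2 * err k) * norm (d k)"
    proof (rule mult_right_mono)
      have "gt (Suc k) - gt k
          = (gt (Suc k) - g (x (Suc k))) + (g (x (Suc k)) - g (x k)) - (gt k - g (x k))" by simp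
      then have "norm (gt (Suc k) - gt k)
          \<le> norm (gt (Suc k) - g (x (Suc k))) + norm (g (x (Suc k)) - g (x k)) + norm (gt k - g (x k))"
        by (smt (verit) norm_triangle_ineq norm_triangle_ineq4)
      moreover have "norm (g (x (Suc k)) - g (x k)) \<le> L * (alpha k * norm (d k))"
        using Lipschitz[of "x (Suc k)" "x k"] alpha[of k] by (simp add: step)
      moreover have "err (Suc k) \<le> err k" using err(2) by (simp add: decseq_SucD)
      ultimately show "norm (gt (Suc k) - gt k) \<le> L * alpha k * norm (d k) + 2 * err k"
        using err(1)[of k] err(1)[of "Suc k"] by (simp add: mult.assoc)
    qed simp
    also have "\<dots> = (L * alpha k + 2 * (err k / norm (d k))) * (norm (d k))\<^sup>2"
      using d[of k] by (simp add: field_simps power2_eq_square)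
    finally show ?thesis using d[of k] by simp
  qed
  \<comment> \<open>Once the error term in \<open>key\<close> is below \<open>A / 2\<close>, the step length carries the other half.\<close>
  define a where "a = A / (2 * L)"
  have a: "a > 0" using A L by (simp add: a_def)
  have "\<forall>\<^sub>F k in sequentially. err k / norm (d k) < A / 4"
    by (rule order_tendstoD(2)[OF err_little_o]) (use A in simp)
  then have step_lower: "\<forall>\<^sub>F k in sequentially. a \<le> alpha k"
  proof eventually_elim
    case (elim k)
    then have "A / 2 \<le> L * alpha k" using key[of k] by linarith
    then show ?case using L by (simp add: a_def field_simps)
  qed
  have "decseq Fa"
  proof (rule decseq_SucI)
    fix k
    have "delta * alpha k * (gt k \<bullet> d k) \<le> 0"
      using delta alpha[of k] neg[of k] by (simp add: mult_le_0_iff)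
    then show "Fa (Suc k) \<le> Fa k" using decrease[of k] by simp
  qed
  then obtain l where l: "Fa \<longlonglongrightarrow> l" using decseq_convergent below by metis
  have "(\<lambda>k. (Fa k - Fa (Suc k)) / (delta * a * eta)) \<longlonglongrightarrow> (l - l) / (delta * a * eta)"
    using delta a eta by (intro tendsto_intros l LIMSEQ_Suc[OF l]) auto
  then have gap: "(\<lambda>k. (Fa k - Fa (Suc k)) / (delta * a * eta)) \<longlonglongrightarrow> 0" by simp
  have "(\<lambda>k. (norm (gt k))\<^sup>2) \<longlonglongrightarrow> 0"
  proof (rule Lim_null_comparison[OF _ gap])
    show "\<forall>\<^sub>F k in sequentially.
        norm ((norm (gt k))\<^sup>2) \<le> (Fa k - Fa (Suc k)) / (delta * a * eta)"
      using step_lower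
    proof eventually_elim
      case (elim k)
      have "a * (eta * (norm (gt k))\<^sup>2) \<le> alpha k * (- (gt k \<bullet> d k))"
        using elim a eta descent[of k] by (intro mult_mono) auto
      then have "delta * (a * (eta * (norm (gt k))\<^sup>2)) \<le> delta * (alpha k * (- (gt k \<bullet> d k)))"
        using delta by (intro mult_left_mono) auto
      also have "\<dots> \<le> Fa k - Fa (Suc k)" using decrease[of k] by (simp add: algebra_simps)
      finally show ?case using delta a eta by (simp add: field_simps)
    qed
  qed
  then have "(\<lambda>k. sqrt ((norm (gt k))\<^sup>2)) \<longlonglongrightarrow> sqrt 0" by (rule tendsto_real_sqrt)
  then show ?thesis by (simp add: tendsto_norm_zero_iff)
qed

section \<open>Convergence of the conjugate gradient method\<close>

theorem theorem3p3:
  fixes f :: "real ^ 'n \<Rightarrow> real"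
    and pa :: "real ^ 'n \<Rightarrow> real \<Rightarrow> real ^ 'n"
    and x d :: "nat \<Rightarrow> real ^ 'n"
    and eps alpha beta theta :: "nat \<Rightarrow> real"
    and lam delta sig eta tau rho :: real
  assumes convex: "convex_on UNIV f"
    and locally_Lipschitz: "\<And>z. \<exists>u>0. \<exists>L. L-lipschitz_on (cball z u) f"
    and lam: "lam > 0"
    and delta_sigma: "0 < delta" "delta \<le> sig" "sig < 1"
    and eta: "0 < eta" "eta < 3/4"
    and tau: "tau > 1/4 + eta"
    and rho: "rho > 0"
    and eps0: "0 < eps 0" "eps 0 < 1"
    and pa: "inexact_prox f lam pa"
    and run: "algorithm_W_run f lam pa delta sig eta tau rho x d eps alpha beta theta"
    and bounded_level_set: "bounded {z. moreau_yosida f lam z \<le> moreau_yosida f lam (x 0)}"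
    and bounded_below: "bdd_below (range f)"
    and eps_decreasing: "decseq eps" "eps \<longlonglongrightarrow> 0"
    and eps_little_o: "(\<lambda>k. eps k / (norm (d k))\<^sup>2) \<longlonglongrightarrow> 0"
  shows "(\<lambda>k. norm (gradient (moreau_yosida f lam) (x k))) \<longlonglongrightarrow> 0 \<and>
         (\<forall>l r. strict_mono r \<longrightarrow> (x \<circ> r) \<longlonglongrightarrow> l \<longrightarrow>
            (\<forall>z. f l \<le> f z) \<and> (\<forall>z. moreau_yosida f lam l \<le> moreau_yosida f lam z))"
proof -
  let ?F = "moreau_yosida f lam" and ?g = "prox_residual f lam"
  define Fa where "Fa = (\<lambda>k. F_inexact f lam pa (x k) (eps k))"
  define gt where "gt = (\<lambda>k. g_inexact lam pa (x k) (eps k))"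
  define err where "err = (\<lambda>k. sqrt (2 * eps k / lam))"
  define C where "C = max 1 tau + 1/4"
  have d0: "d 0 = - gt 0"
    and nonzero: "\<And>k. gt k \<noteq> 0"
    and eps_Suc: "\<And>k. 0 < eps (Suc k)"
    and alpha: "\<And>k. 0 < alpha k"
    and step: "\<And>k. x (Suc k) = x k + alpha k *\<^sub>R d k"
    and dSuc: "\<And>k. d (Suc k)
      = - theta_W eta tau rho (d k) (gt (Suc k) - gt k) (gt (Suc k)) *\<^sub>R gt (Suc k)
        + beta_W rho (d k) (gt (Suc k) - gt k) (gt (Suc k)) *\<^sub>R d k"
    using run unfolding algorithm_W_run_def Let_def gt_def by auto
  \<comment> \<open>Rewriting with \<open>step\<close> identifies the trial point of the line search with \<open>x (Suc k)\<close>.\<close>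
  have decrease: "Fa (Suc k) - Fa k \<le> delta * alpha k * (gt k \<bullet> d k)"
    and curvature: "gt (Suc k) \<bullet> d k \<ge> sig * (gt k \<bullet> d k)" for k
    using run unfolding algorithm_W_run_def Let_def Fa_def gt_def step by auto
  have eps_pos: "0 < eps k" for k using eps0 eps_Suc by (cases k) auto
  have dirs: "gt k \<bullet> d k \<le> - eta * (norm (gt k))\<^sup>2 \<and> norm (d k) \<le> C * norm (gt k)" for k
  proof (cases k)
    case 0
    have "eta * (norm (gt 0))\<^sup>2 \<le> 1 * (norm (gt 0))\<^sup>2" using eta by (intro mult_right_mono) auto
    moreover have "1 * norm (gt 0) \<le> C * norm (gt 0)"
      by (intro mult_right_mono) (auto simp: C_def)
    ultimately show ?thesis by (simp add: 0 d0 power2_norm_eq_inner)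
  next
    case (Suc j)
    have "0 \<le> theta_W eta tau rho (d j) (gt (Suc j) - gt j) (gt (Suc j))"
      using theta_W_bounds(1)[OF eta(2)] eta(1) by (smt (verit) divide_nonneg_nonneg)
    then show ?thesis
      unfolding Suc dSuc C_def
      by (intro conjI truncated_direction_descent truncated_direction_norm
          abs_beta_W_le theta_W_bounds eta(2))
  qed
  obtain m where m: "\<And>z. m \<le> f z" using bounded_below by (auto simp: bdd_below_def)
  have below: "m \<le> Fa k" for k
  proof -
    have "f (pa (x k) (eps k)) \<le> Fa k"
      using lam by (simp add: Fa_def F_inexact_def my_objective_def)
    then show ?thesis using m order_trans by blast
  qed
  have g_err: "norm (gt k - ?g (x k)) \<le> err k" for k
    unfolding gt_def err_def by (rule g_inexact_error[OF convex lam pa eps_pos])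
  have err_dec: "decseq err"
    using eps_decreasing(1) lam unfolding err_def decseq_def
    by (auto intro!: divide_right_mono)
  have "(\<lambda>k. sqrt (2 / lam * (eps k / (norm (d k))\<^sup>2))) \<longlonglongrightarrow> sqrt (2 / lam * 0)"
    by (intro tendsto_intros eps_little_o)
  moreover have "sqrt (2 / lam * (eps k / (norm (d k))\<^sup>2)) = err k / norm (d k)" for k
    by (simp add: err_def real_sqrt_divide real_sqrt_mult)
  ultimately have err_o: "(\<lambda>k. err k / norm (d k)) \<longlonglongrightarrow> 0" by simp
  have gt: "gt \<longlonglongrightarrow> 0"
  proof (rule wolfe_inexact_gradient_tendsto_zero[where g = ?g and L = "1 / lam" and C = C
        and x = x and d = d and Fa = Fa and alpha = alpha and err = err and delta = delta
        and sig = sig and eta = eta and m = m])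
    show "norm (?g u - ?g v) \<le> 1 / lam * norm (u - v)" for u v
      using prox_residual_Lipschitz[OF convex lam, of u v] by simp
    show "C > 0" by (simp add: C_def)
    show "1 / lam > 0" using lam by simp
    show "gt k \<bullet> d k \<le> - eta * (norm (gt k))\<^sup>2" "norm (d k) \<le> C * norm (gt k)" for k
      using dirs by blast+
  qed (fact delta_sigma eta step alpha below decrease curvature nonzero g_err err_dec err_o)+
  have "err \<longlonglongrightarrow> sqrt (2 * 0 / lam)"
    unfolding err_def using lam by (intro tendsto_intros eps_decreasing(2)) auto
  then have "err \<longlonglongrightarrow> 0" by simp
  then have "(\<lambda>k. gt k - ?g (x k)) \<longlonglongrightarrow> 0"
    by (rule Lim_null_comparison[rotated]) (simp add: g_err)
  from tendsto_diff[OF gt this] have g: "(\<lambda>k. ?g (x k)) \<longlonglongrightarrow> 0" by simp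
  have stationary: "?g l = 0" if r: "strict_mono r" and l: "(x \<circ> r) \<longlonglongrightarrow> l" for l and r :: "nat \<Rightarrow> nat"
  proof -
    have "(\<lambda>k. norm ((x \<circ> r) k - l) / lam) \<longlonglongrightarrow> norm (l - l) / lam"
      using lam by (intro tendsto_intros l) auto
    then have "(\<lambda>k. norm ((x \<circ> r) k - l) / lam) \<longlonglongrightarrow> 0" by simp
    then have "(\<lambda>k. ?g (x (r k)) - ?g l) \<longlonglongrightarrow> 0"
      by (rule Lim_null_comparison[rotated])
        (use prox_residual_Lipschitz[OF convex lam] in auto)
    then have "(\<lambda>k. ?g (x (r k))) \<longlonglongrightarrow> ?g l" by (rule LIM_zero_cancel)
    moreover have "(\<lambda>k. ?g (x (r k))) \<longlonglongrightarrow> 0"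
      using LIMSEQ_subseq_LIMSEQ[OF g r] by (simp add: o_def)
    ultimately show ?thesis by (rule LIMSEQ_unique)
  qed
  show ?thesis
    using tendsto_norm_zero[OF g] stationary_imp_minimizer[OF convex lam stationary]
    unfolding gradient_moreau_yosida[OF convex lam] by blast
qed

end
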